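(* For every $n\ge 2$, the representation $\widehat{\rho}_G : Cb_n\to \mathrm{GL}_n(R)$, $R=\mathbb{Z}[t_1^{\pm1},\dots,t_n^{\pm1}]$, has a non-trivial kernel.
   Context: $F_n$ is the free group with free basis $x_1,\dots,x_n$. Automorphisms act on the right, so in a product $\alpha\beta$ the automorphism $\alpha$ is applied first: $x^{\alpha\beta}=(x^\alpha)^\beta$. $Cb_n$ is the group of basis-conjugating automorphisms of $F_n$: automorphisms sending each $x_i$ to $f_i^{-1}x_if_i$ for some $f_i\in F_n$. Fox derivatives $\partial/\partial x_j:\mathbb{Z}F_n\to\mathbb{Z}F_n$ are the additive maps with $\partial x_i/\partial x_j=\delta_{ij}$ and $\partial(wv)/\partial x_j=(\partial w/\partial x_j)\,v^\tau+w\,\partial v/\partial x_j$, where $\tau:\mathbb{Z}F_n\to\mathbb{Z}$ is the augmentation. Let $\varphi$ be the homomorphism from $F_n$ onto the free abelian group with basis $t_1,\dots,t_n$, $x_i\mapsto t_i$, extended to $\mathbb{Z}F_n\to R$. The representation $\widehat{\rho}_G$ is the Magnus representation $\widehat{\rho}_G(\alpha)=\left[\left(\partial(x_i^\alpha)/\partial x_j\right)^\varphi\right]_{i,j=1}^n$ for $\alpha\in Cb_n$. *)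

theory Defs
  imports "HOL-Analysis.Cartesian_Space" "HOL-Library.Poly_Mapping" "HOL-Algebra.Coset"
begin

section \<open>Free groups\<close>

text \<open>
  The free group on the basis \<^typ>\<open>'n\<close>, written additively and as an instance of the (non-commutative)
  class \<^class>\<open>group_add\<close>, so that \<^typ>\<open>'g \<Rightarrow>\<^sub>0 int\<close> with the convolution product of
  \<^theory>\<open>HOL-Library.Poly_Mapping\<close> is its integral group ring.  In words, the letter \<open>(i, True)\<close>
  stands for \<open>x\<^sub>i\<close> and \<open>(i, False)\<close> for its inverse.
\<close>

inductive word_eq :: "('n \<times> bool) list \<Rightarrow> ('n \<times> bool) list \<Rightarrow> bool" where
  refl: "word_eq u u"
| sym: "word_eq u v \<Longrightarrow> word_eq v u"
| trans: "word_eq u v \<Longrightarrow> word_eq v w \<Longrightarrow> word_eq u w"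
| cancel: "word_eq (u @ (i, b) # (i, \<not> b) # v) (u @ v)"

lemma equivp_word_eq: "equivp word_eq"
  by (intro equivpI reflpI sympI transpI) (blast intro: word_eq.intros)+

quotient_type 'n free_group = "('n \<times> bool) list" / word_eq
  by (rule equivp_word_eq)

definition inv_word :: "('n \<times> bool) list \<Rightarrow> ('n \<times> bool) list"
  where "inv_word w = rev (map (\<lambda>(i, b). (i, \<not> b)) w)"

lemma word_eq_append_left: "word_eq u v \<Longrightarrow> word_eq (w @ u) (w @ v)"
proof (induction rule: word_eq.induct)
  case (cancel u i b v)
  show ?case using word_eq.cancel[of "w @ u" i b v] by simp
qed (blast intro: word_eq.intros)+

lemma word_eq_append_right: "word_eq u v \<Longrightarrow> word_eq (u @ w) (v @ w)"
proof (induction rule: word_eq.induct)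
  case (cancel u i b v)
  show ?case using word_eq.cancel[of u i b "v @ w"] by simp
qed (blast intro: word_eq.intros)+

lemma word_eq_append: "word_eq u u' \<Longrightarrow> word_eq v v' \<Longrightarrow> word_eq (u @ v) (u' @ v')"
  by (blast intro: word_eq_append_left word_eq_append_right word_eq.trans)

lemma word_eq_inv_word: "word_eq u v \<Longrightarrow> word_eq (inv_word u) (inv_word v)"
proof (induction rule: word_eq.induct)
  case (cancel u i b v)
  show ?case using word_eq.cancel[of "inv_word v" i b "inv_word u"] by (simp add: inv_word_def)
qed (blast intro: word_eq.intros)+

lemma word_eq_inv_word_append: "word_eq (inv_word w @ w) []"
proof (induction w)
  case Nil
  show ?case by (simp add: inv_word_def word_eq.refl)
next
  case (Cons a w)
  obtain i b where a: "a = (i, b)" by (cases a)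
  show ?case
    using word_eq.trans[OF word_eq.cancel[of "inv_word w" i "\<not> b" w] Cons.IH]
    by (simp add: a inv_word_def)
qed

instantiation free_group :: (type) group_add
begin

lift_definition zero_free_group :: "'a free_group" is "[]" .

lift_definition plus_free_group :: "'a free_group \<Rightarrow> 'a free_group \<Rightarrow> 'a free_group" is "(@)"
  by (rule word_eq_append)

lift_definition uminus_free_group :: "'a free_group \<Rightarrow> 'a free_group" is inv_word
  by (rule word_eq_inv_word)

definition minus_free_group :: "'a free_group \<Rightarrow> 'a free_group \<Rightarrow> 'a free_group"
  where "minus_free_group g h = g + - h"

instance
proof
  fix a b c :: "'a free_group"
  show "a + b + c = a + (b + c)" by transfer (simp add: word_eq.refl)
  show "0 + a = a" by transfer (simp add: word_eq.refl)
  show "a + 0 = a" by transfer (simp add: word_eq.refl)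
  show "- a + a = 0" by transfer (rule word_eq_inv_word_append)
  show "a + - b = a - b" by (simp add: minus_free_group_def)
qed

end

lift_definition gen :: "'n \<Rightarrow> 'n free_group" is "\<lambda>i. [(i, True)]" .

definition letter_map :: "('n \<Rightarrow> 'g::group_add) \<Rightarrow> 'n \<times> bool \<Rightarrow> 'g"
  where "letter_map f = (\<lambda>(i, b). if b then f i else - f i)"

lemma sum_list_letter_map:
  "word_eq u v \<Longrightarrow> sum_list (map (letter_map f) u) = sum_list (map (letter_map f) v)"
proof (induction rule: word_eq.induct)
  case (cancel u i b v)
  show ?case by (simp add: letter_map_def add.assoc[symmetric])
qed auto

text \<open>The homomorphism extending a map on the basis.\<close>

lift_definition free_lift :: "('n \<Rightarrow> 'g::group_add) \<Rightarrow> 'n free_group \<Rightarrow> 'g"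
  is "\<lambda>f w. sum_list (map (letter_map f) w)"
  by (rule sum_list_letter_map)

lemma free_lift_gen [simp]: "free_lift f (gen i) = f i"
  by transfer (simp add: letter_map_def)

lemma free_lift_add [simp]: "free_lift f (g + h) = free_lift f g + free_lift f h"
  by transfer simp

lemma free_group_induct [case_names zero gen_add minus_gen_add]:
  assumes "P 0" "\<And>i g. P g \<Longrightarrow> P (gen i + g)" "\<And>i g. P g \<Longrightarrow> P (- gen i + g)"
  shows "P g"
proof -
  have "P (abs_free_group w)" for w
  proof (induction w)
    case Nil
    then show ?case using assms(1) by (simp add: zero_free_group.abs_eq)
  next
    case (Cons a w)
    obtain i b where a: "a = (i, b)" by (cases a)
    have "abs_free_group (a # w) = (if b then gen i else - gen i) + abs_free_group w"
      by (simp add: a gen.abs_eq plus_free_group.abs_eq uminus_free_group.abs_eq inv_word_def)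
    then show ?case using assms(2,3)[OF Cons.IH] by simp
  qed
  then show ?thesis by (rule free_group.abs_induct)
qed

lemma add_hom_zero:
  fixes F :: "'g::group_add \<Rightarrow> 'h::group_add"
  assumes "\<And>g h. F (g + h) = F g + F h"
  shows "F 0 = 0"
proof -
  have "F 0 + F 0 = F 0 + 0" using assms[of 0 0] by simp
  then show ?thesis by (rule add_left_imp_eq)
qed

lemma add_hom_minus:
  fixes F :: "'g::group_add \<Rightarrow> 'h::group_add"
  assumes "\<And>g h. F (g + h) = F g + F h"
  shows "F (- g) = - F g"
proof -
  have "F (- g) + F g = 0" using assms[of "- g" g] add_hom_zero[of F, OF assms] by simp
  then show ?thesis by (simp only: eq_neg_iff_add_eq_0)
qed

lemma free_lift_zero [simp]: "free_lift f 0 = 0"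
  by (rule add_hom_zero) (rule free_lift_add)

lemma free_lift_minus [simp]: "free_lift f (- g) = - free_lift f g"
  by (rule add_hom_minus) (rule free_lift_add)

lemma free_lift_unique:
  assumes F: "\<And>g h. F (g + h) = F g + F h" and f: "\<And>i. F (gen i) = f i"
  shows "F = free_lift (f :: 'n \<Rightarrow> 'g::group_add)"
proof
  have F0: "F 0 = 0" using F by (rule add_hom_zero)
  have Fm: "F (- g) = - F g" for g using F by (rule add_hom_minus)
  show "F g = free_lift f g" for g
  proof (induction g rule: free_group_induct)
    case zero
    show ?case by (simp add: F0)
  next
    case (gen_add i g)
    then show ?case by (simp add: F f)
  next
    case (minus_gen_add i g)
    then show ?case by (simp only: F Fm f free_lift_add free_lift_minus free_lift_gen)
  qed
qed


section \<open>Basis-conjugating automorphisms\<close>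

text \<open>Automorphisms act on the right, so the product of \<open>\<alpha>\<close> and \<open>\<beta>\<close> applies \<open>\<alpha>\<close> first.\<close>

definition Cb :: "('n free_group \<Rightarrow> 'n free_group) monoid"
  where "Cb = \<lparr>carrier = {\<alpha>. bij \<alpha> \<and> (\<forall>g h. \<alpha> (g + h) = \<alpha> g + \<alpha> h) \<and>
                             (\<forall>i. \<exists>f. \<alpha> (gen i) = - f + gen i + f)},
               monoid.mult = (\<lambda>\<alpha> \<beta>. \<beta> \<circ> \<alpha>), one = id\<rparr>"


section \<open>Fox derivatives\<close>

type_synonym 'n group_ring = "'n free_group \<Rightarrow>\<^sub>0 int"

definition augmentation :: "'n group_ring \<Rightarrow> int"
  where "augmentation a = (\<Sum>g \<in> Poly_Mapping.keys a. Poly_Mapping.lookup a g)"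

definition is_fox_derivative :: "'n \<Rightarrow> ('n group_ring \<Rightarrow> 'n group_ring) \<Rightarrow> bool"
  where "is_fox_derivative j D \<longleftrightarrow>
    additive D \<and>
    (\<forall>i. D (frag_of (gen i)) = (if i = j then 1 else 0)) \<and>
    (\<forall>w v. D (w * v) = D w * of_int (augmentation v) + w * D v)"

lemma frag_of_mult: "frag_of g * frag_of h = frag_of (g + h)"
  by (simp add: mult_single)

lemma frag_of_0: "frag_of 0 = 1"
  by (rule single_one)

lemma additive_frag_ext:
  fixes F G :: "('a \<Rightarrow>\<^sub>0 int) \<Rightarrow> 'b::ab_group_add"
  assumes "additive F" "additive G" "\<And>g. F (frag_of g) = G (frag_of g)"
  shows "F a = G a"
  by (induction a rule: frag_induction[OF subset_UNIV])
    (simp_all add: additive.zero[OF assms(1)] additive.zero[OF assms(2)]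
       additive.diff[OF assms(1)] additive.diff[OF assms(2)] assms(3))

lemma additive_frag_extend: "additive (frag_extend b)"
  by (simp add: additive_def frag_extend_add)

lemma augmentation_eq: "augmentation a = Poly_Mapping.lookup (frag_extend (\<lambda>_. frag_of ()) a) ()"
  by (simp add: augmentation_def frag_extend_def lookup_sum)

lemma additive_augmentation: "additive augmentation"
  by (simp add: additive_def augmentation_eq frag_extend_add lookup_add)

lemma augmentation_frag_of [simp]: "augmentation (frag_of g) = 1"
  by (simp add: augmentation_eq)

primrec fox_word :: "'n \<Rightarrow> ('n \<times> bool) list \<Rightarrow> 'n group_ring" where
  "fox_word j [] = 0"
| "fox_word j (a # w) =
     (case a of (i, b) \<Rightarrow>
        (if i = j then (if b then 1 else - frag_of (- gen i)) else 0) +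
        frag_of (if b then gen i else - gen i) * fox_word j w)"

lemma abs_free_group_Cons:
  "abs_free_group ((i, b) # w) = (if b then gen i else - gen i) + abs_free_group w"
  by (simp add: gen.abs_eq plus_free_group.abs_eq uminus_free_group.abs_eq inv_word_def)

lemma fox_word_append:
  "fox_word j (u @ v) = fox_word j u + frag_of (abs_free_group u) * fox_word j v"
  by (induction u)
    (auto simp: abs_free_group_Cons frag_of_mult[symmetric] algebra_simps frag_of_0
       simp flip: zero_free_group.abs_eq)

lemma fox_word_cong: "word_eq u v \<Longrightarrow> fox_word j u = fox_word j v"
proof (induction rule: word_eq.induct)
  case (cancel u i b v)
  show ?case
    by (simp add: fox_word_append algebra_simps frag_of_mult frag_of_0 mult.assoc[symmetric])
qed auto

lift_definition fox_group :: "'n \<Rightarrow> 'n free_group \<Rightarrow> 'n group_ring" is fox_word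
  by (rule fox_word_cong)

lemma fox_group_gen: "fox_group j (gen i) = (if i = j then 1 else 0)"
  by transfer simp

lemma fox_group_add: "fox_group j (g + h) = fox_group j g + frag_of g * fox_group j h"
proof (induction g rule: free_group.abs_induct)
  case (1 u)
  show ?case
    by (induction h rule: free_group.abs_induct)
      (simp add: plus_free_group.abs_eq fox_group.abs_eq fox_word_append)
qed

lemma is_fox_derivative_fox_group: "is_fox_derivative j (frag_extend (fox_group j))"
proof -
  let ?D = "frag_extend (fox_group j)"
  have "?D (w * v) = ?D w * of_int (augmentation v) + w * ?D v" for w v
  proof (rule additive_frag_ext[where F = "\<lambda>v. ?D (w * v)" and
        G = "\<lambda>v. ?D w * of_int (augmentation v) + w * ?D v"])
    show "additive (\<lambda>v. ?D (w * v))"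
      by (simp add: additive_def frag_extend_add distrib_left)
    show "additive (\<lambda>v. ?D w * of_int (augmentation v) + w * ?D v)"
      by (simp add: additive_def frag_extend_add algebra_simps additive.add[OF additive_augmentation])
    fix h
    have "?D (w * frag_of h) = ?D w + w * fox_group j h"
      by (rule additive_frag_ext[where F = "\<lambda>w. ?D (w * frag_of h)" and
            G = "\<lambda>w. ?D w + w * fox_group j h"])
        (simp_all add: additive_def frag_extend_add distrib_right frag_of_mult fox_group_add)
    then show "?D (w * frag_of h) =
        ?D w * of_int (augmentation (frag_of h)) + w * ?D (frag_of h)"
      by simp
  qed
  then show ?thesis
    by (simp add: is_fox_derivative_def additive_frag_extend fox_group_gen)
qed

lemma is_fox_derivative_frag_of:
  assumes "is_fox_derivative j D"
  shows "D (frag_of (g + h)) = D (frag_of g) + frag_of g * D (frag_of h)"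
  using assms unfolding is_fox_derivative_def frag_of_mult[symmetric] by simp

lemma is_fox_derivative_zero:
  assumes "is_fox_derivative j D"
  shows "D 1 = 0"
  using is_fox_derivative_frag_of[OF assms, of 0 0] by (simp add: frag_of_0)

lemma is_fox_derivative_minus:
  assumes "is_fox_derivative j D"
  shows "D (frag_of (- g)) = - (frag_of (- g) * D (frag_of g))"
  using is_fox_derivative_frag_of[OF assms, of "- g" g] is_fox_derivative_zero[OF assms]
  by (simp add: eq_neg_iff_add_eq_0)

lemma ex1_fox_derivative: "\<exists>!D. is_fox_derivative j D"
proof (rule ex1I)
  show "is_fox_derivative j (frag_extend (fox_group j))"
    by (rule is_fox_derivative_fox_group)
next
  fix D assume D: "is_fox_derivative j D"
  let ?E = "frag_extend (fox_group j)"
  note E = is_fox_derivative_fox_group[of j]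
  have "D (frag_of g) = ?E (frag_of g)" for g
  proof (induction g rule: free_group_induct)
    case zero
    show ?case using is_fox_derivative_zero[OF D] is_fox_derivative_zero[OF E] by simp
  next
    case (gen_add i g)
    have "D (frag_of (gen i)) = ?E (frag_of (gen i))"
      using D E by (simp add: is_fox_derivative_def)
    then show ?case
      using gen_add by (simp only: is_fox_derivative_frag_of[OF D] is_fox_derivative_frag_of[OF E])
  next
    case (minus_gen_add i g)
    have "D (frag_of (gen i)) = ?E (frag_of (gen i))"
      using D E by (simp add: is_fox_derivative_def)
    then show ?case
      using minus_gen_add
      by (simp only: is_fox_derivative_frag_of[OF D] is_fox_derivative_frag_of[OF E]
            is_fox_derivative_minus[OF D] is_fox_derivative_minus[OF E])
  qed
  then show "D = ?E"
    using additive_frag_ext[of D ?E] D E unfolding is_fox_derivative_def by blast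
qed

definition fox :: "'n \<Rightarrow> 'n group_ring \<Rightarrow> 'n group_ring"
  where "fox j = (THE D. is_fox_derivative j D)"


lemma is_fox_derivative_fox: "is_fox_derivative j (fox j)"
  unfolding fox_def by (rule theI'[OF ex1_fox_derivative])

lemma fox_gen: "fox j (frag_of (gen i)) = (if i = j then 1 else 0)"
  using is_fox_derivative_fox[of j] unfolding is_fox_derivative_def by blast


section \<open>The Magnus representation\<close>

text \<open>
  \<^typ>\<open>'n \<Rightarrow>\<^sub>0 int\<close> is the free abelian group on \<^typ>\<open>'n\<close>, written additively; its integral group ring is the
  ring of Laurent polynomials in commuting variables \<open>t\<^sub>i\<close>, where \<open>t\<^sub>i\<close> is \<open>frag_of (frag_of i)\<close>.
\<close>

type_synonym 'n laurent = "('n \<Rightarrow>\<^sub>0 int) \<Rightarrow>\<^sub>0 int"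

definition abelianize :: "'n group_ring \<Rightarrow> 'n laurent"
  where "abelianize = frag_extend (\<lambda>g. frag_of (free_lift frag_of g))"

definition GL :: "('r::semiring_1 ^ 'n ^ 'n) monoid"
  where "GL = \<lparr>carrier = {A. invertible A}, monoid.mult = (**), one = mat 1\<rparr>"

definition magnus :: "('n free_group \<Rightarrow> 'n free_group) \<Rightarrow> 'n::finite laurent ^ 'n ^ 'n"
  where "magnus \<alpha> = (\<chi> i j. abelianize (fox j (frag_of (\<alpha> (gen i)))))"

lemma additive_abelianize: "additive abelianize"
  by (simp add: abelianize_def additive_frag_extend)

lemma abelianize_frag_of: "abelianize (frag_of g) = frag_of (free_lift frag_of g)"
  by (simp add: abelianize_def)

lemma abelianize_mult: "abelianize (a * b) = abelianize a * abelianize b"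
proof (rule additive_frag_ext[where F = "\<lambda>b. abelianize (a * b)" and
      G = "\<lambda>b. abelianize a * abelianize b"])
  show "additive (\<lambda>b. abelianize (a * b))" "additive (\<lambda>b. abelianize a * abelianize b)"
    by (simp_all add: additive_def distrib_left additive.add[OF additive_abelianize])
  show "abelianize (a * frag_of h) = abelianize a * abelianize (frag_of h)" for h
    by (rule additive_frag_ext[where F = "\<lambda>a. abelianize (a * frag_of h)" and
          G = "\<lambda>a. abelianize a * abelianize (frag_of h)"])
      (simp_all add: additive_def distrib_right additive.add[OF additive_abelianize]
         frag_of_mult abelianize_frag_of)
qed

lemma CbD:
  assumes "\<alpha> \<in> carrier Cb"
  shows "bij \<alpha>" "\<alpha> (g + h) = \<alpha> g + \<alpha> h" "\<exists>f. \<alpha> (gen i) = - f + gen i + f"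
    "\<alpha> 0 = 0" "\<alpha> (- g) = - \<alpha> g"
proof -
  show *: "bij \<alpha>" "\<alpha> (g + h) = \<alpha> g + \<alpha> h" "\<exists>f. \<alpha> (gen i) = - f + gen i + f" for g h
    using assms by (simp_all add: Cb_def)
  show "\<alpha> 0 = 0" "\<alpha> (- g) = - \<alpha> g"
    using add_hom_zero[of \<alpha>] add_hom_minus[of \<alpha>] *(2) by blast+
qed

lemma Cb_comp:
  assumes \<alpha>: "\<alpha> \<in> carrier Cb" and \<beta>: "\<beta> \<in> carrier Cb"
  shows "\<beta> \<circ> \<alpha> \<in> carrier Cb"
proof -
  have "\<exists>f. \<beta> (\<alpha> (gen i)) = - f + gen i + f" for i
  proof -
    obtain f f' where "\<alpha> (gen i) = - f + gen i + f" "\<beta> (gen i) = - f' + gen i + f'"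
      using CbD(3)[OF \<alpha>] CbD(3)[OF \<beta>] by blast
    then have "\<beta> (\<alpha> (gen i)) = - (f' + \<beta> f) + gen i + (f' + \<beta> f)"
      by (simp only: CbD[OF \<beta>] minus_add add.assoc)
    then show ?thesis by blast
  qed
  then show ?thesis
    using CbD(1,2)[OF \<alpha>] CbD(1,2)[OF \<beta>] by (simp add: Cb_def bij_comp)
qed

lemma Cb_inv:
  assumes \<alpha>: "\<alpha> \<in> carrier Cb"
  shows "inv_into UNIV \<alpha> \<in> carrier Cb"
proof -
  let ?\<gamma> = "inv_into UNIV \<alpha>"
  have \<alpha>\<gamma>: "\<alpha> (?\<gamma> g) = g" and \<gamma>\<alpha>: "?\<gamma> (\<alpha> g) = g" for g
    using CbD(1)[OF \<alpha>] by (simp_all add: bij_is_surj surj_f_inv_f bij_is_inj)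
  have add: "?\<gamma> (g + h) = ?\<gamma> g + ?\<gamma> h" for g h
    using \<gamma>\<alpha>[of "?\<gamma> g + ?\<gamma> h"] by (simp add: CbD(2)[OF \<alpha>] \<alpha>\<gamma>)
  have "\<exists>f. ?\<gamma> (gen i) = - f + gen i + f" for i
  proof -
    obtain f where f: "\<alpha> (gen i) = - f + gen i + f"
      using CbD(3)[OF \<alpha>] by blast
    have "gen i = ?\<gamma> (- f + gen i + f)" by (simp add: f[symmetric] \<gamma>\<alpha>)
    also have "\<dots> = - ?\<gamma> f + ?\<gamma> (gen i) + ?\<gamma> f"
      by (simp only: add add_hom_minus[of ?\<gamma>, OF add])
    finally have *: "gen i = - ?\<gamma> f + ?\<gamma> (gen i) + ?\<gamma> f" .
    have "?\<gamma> (gen i) = - (- ?\<gamma> f) + (- ?\<gamma> f + ?\<gamma> (gen i) + ?\<gamma> f) + - ?\<gamma> f"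
      by (simp only: add.assoc minus_minus add_minus_cancel right_minus add_0_right)
    then have "?\<gamma> (gen i) = - (- ?\<gamma> f) + gen i + - ?\<gamma> f"
      by (simp only: *[symmetric])
    then show ?thesis by blast
  qed
  then show ?thesis
    using CbD(1)[OF \<alpha>] add by (simp add: Cb_def bij_imp_bij_inv)
qed

lemma group_Cb: "group (Cb :: ('n free_group \<Rightarrow> 'n free_group) monoid)"
proof (rule groupI)
  fix \<alpha> :: "'n free_group \<Rightarrow> 'n free_group" assume \<alpha>: "\<alpha> \<in> carrier Cb"
  show "\<exists>\<beta>\<in>carrier Cb. \<beta> \<otimes>\<^bsub>Cb\<^esub> \<alpha> = \<one>\<^bsub>Cb\<^esub>"
    using Cb_inv[OF \<alpha>] surj_iff[THEN iffD1, OF bij_is_surj[OF CbD(1)[OF \<alpha>]]]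
    by (intro bexI[of _ "inv_into UNIV \<alpha>"]) (simp_all add: Cb_def)
next
  have "\<exists>f. gen i = - f + gen i + f" for i :: 'n
    by (rule exI[of _ 0]) simp
  then show "\<one>\<^bsub>Cb\<^esub> \<in> carrier (Cb :: ('n free_group \<Rightarrow> 'n free_group) monoid)"
    by (simp add: Cb_def)
next
  fix \<alpha> \<beta> :: "'n free_group \<Rightarrow> 'n free_group"
  assume "\<alpha> \<in> carrier Cb" "\<beta> \<in> carrier Cb"
  then show "\<alpha> \<otimes>\<^bsub>Cb\<^esub> \<beta> \<in> carrier Cb"
    using Cb_comp[of \<alpha> \<beta>] by (simp add: Cb_def)
qed (simp_all add: Cb_def comp_assoc)

lemma group_GL: "group (GL :: ('r::semiring_1 ^ 'n ^ 'n) monoid)"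
proof (rule groupI)
  fix A :: "'r::semiring_1 ^ 'n ^ 'n" assume "A \<in> carrier GL"
  then obtain B where "A ** B = mat 1" "B ** A = mat 1"
    by (auto simp: GL_def invertible_def)
  then show "\<exists>B\<in>carrier GL. B \<otimes>\<^bsub>GL\<^esub> A = \<one>\<^bsub>GL\<^esub>"
    by (auto simp: GL_def invertible_def)
next
  fix A B :: "'r::semiring_1 ^ 'n ^ 'n" assume "A \<in> carrier GL" "B \<in> carrier GL"
  then show "A \<otimes>\<^bsub>GL\<^esub> B \<in> carrier GL"
    by (simp add: GL_def invertible_mult)
next
  show "\<one>\<^bsub>GL\<^esub> \<in> carrier (GL :: ('r ^ 'n ^ 'n) monoid)"
    by (auto simp: GL_def invertible_def intro!: exI[of _ "mat 1"])
qed (simp_all add: GL_def matrix_mul_assoc)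

lemma abelianize_Cb:
  assumes "\<beta> \<in> carrier Cb"
  shows "abelianize (frag_of (\<beta> g)) = abelianize (frag_of g)"
proof -
  have "(\<lambda>g. free_lift frag_of (\<beta> g)) = free_lift frag_of"
  proof (rule free_lift_unique)
    show "free_lift frag_of (\<beta> (g + h)) = free_lift frag_of (\<beta> g) + free_lift frag_of (\<beta> h)" for g h
      by (simp add: CbD(2)[OF assms])
    show "free_lift frag_of (\<beta> (gen i)) = frag_of i" for i
    proof -
      obtain f where f: "\<beta> (gen i) = - f + gen i + f" using CbD(3)[OF assms] by blast
      show ?thesis by (simp add: f)
    qed
  qed
  then show ?thesis by (metis abelianize_frag_of)
qed

lemma fox_chain_rule:
  fixes \<beta> :: "'n::finite free_group \<Rightarrow> 'n free_group"
  assumes \<beta>: "\<beta> \<in> carrier Cb"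
  shows "abelianize (fox j (frag_of (\<beta> g))) =
    (\<Sum>k\<in>UNIV. abelianize (fox k (frag_of g)) * abelianize (fox j (frag_of (\<beta> (gen k)))))"
proof -
  note D = is_fox_derivative_frag_of[OF is_fox_derivative_fox]
    is_fox_derivative_zero[OF is_fox_derivative_fox]
    is_fox_derivative_minus[OF is_fox_derivative_fox] fox_gen
  note A = additive.zero[OF additive_abelianize] additive.add[OF additive_abelianize]
    additive.minus[OF additive_abelianize] additive.diff[OF additive_abelianize] abelianize_mult
  have A1: "abelianize 1 = 1"
    using abelianize_frag_of[of 0] by (simp add: frag_of_0)
  have A_if: "abelianize (if P then 1 else 0) = (if P then 1 else 0)" for P
    by (simp add: A A1)
  have A_if2: "abelianize (if P then - x else 0) = (if P then - abelianize x else 0)" for P x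
    by (simp add: A)
  have \<beta>m: "abelianize (frag_of (- \<beta> g)) = abelianize (frag_of (- g))" for g
    using abelianize_Cb[OF \<beta>, of "- g"] by (simp only: CbD[OF \<beta>])
  show ?thesis
  proof (induction g rule: free_group_induct)
    case zero
    show ?case by (simp add: CbD[OF \<beta>] D A)
  next
    case (gen_add i g)
    show ?case
      by (simp add: CbD[OF \<beta>] D A A_if abelianize_Cb[OF \<beta>] gen_add distrib_right sum.distrib
          sum_distrib_left mult.assoc if_distrib[of "\<lambda>x. x * _"] cong: if_cong)
  next
    case (minus_gen_add i g)
    show ?case
      by (simp add: CbD[OF \<beta>] D A A_if A_if2 abelianize_Cb[OF \<beta>] \<beta>m minus_gen_add left_diff_distrib
          distrib_right sum.distrib sum_subtractf sum_distrib_left mult.assoc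
          if_distrib[of "\<lambda>x. x * _"] if_distrib[of "\<lambda>x. _ * x"] if_distrib[of uminus] cong: if_cong)
  qed
qed

lemma magnus_mult:
  assumes "\<beta> \<in> carrier Cb"
  shows "magnus (\<beta> \<circ> \<alpha>) = magnus \<alpha> ** magnus \<beta>"
proof -
  have "magnus (\<beta> \<circ> \<alpha>) $ i $ j = (magnus \<alpha> ** magnus \<beta>) $ i $ j" for i j
    using fox_chain_rule[OF assms, of j "\<alpha> (gen i)"]
    by (simp add: magnus_def matrix_matrix_mult_def)
  then show ?thesis by (simp add: vec_eq_iff)
qed

lemma magnus_id: "magnus id = mat 1"
proof -
  have "abelianize 1 = 1"
    using abelianize_frag_of[of 0] by (simp add: frag_of_0)
  then show ?thesis
    by (simp add: magnus_def mat_def vec_eq_iff fox_gen additive.zero[OF additive_abelianize])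
qed

lemma group_hom_magnus:
  "group_hom (Cb :: ('n::finite free_group \<Rightarrow> 'n free_group) monoid) GL magnus"
proof -
  have "invertible (magnus \<alpha>)" if \<alpha>: "\<alpha> \<in> carrier Cb" for \<alpha> :: "'n free_group \<Rightarrow> 'n free_group"
  proof -
    let ?\<gamma> = "inv_into UNIV \<alpha>"
    have "?\<gamma> \<circ> \<alpha> = id" "\<alpha> \<circ> ?\<gamma> = id"
      using CbD(1)[OF \<alpha>] surj_iff[of \<alpha>] by (simp_all add: bij_is_inj bij_is_surj)
    then have "magnus \<alpha> ** magnus ?\<gamma> = mat 1" "magnus ?\<gamma> ** magnus \<alpha> = mat 1"
      using magnus_mult[OF Cb_inv[OF \<alpha>], of \<alpha>] magnus_mult[OF \<alpha>, of ?\<gamma>] magnus_id by metis+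
    then show ?thesis unfolding invertible_def by blast
  qed
  moreover have mult: "\<alpha> \<otimes>\<^bsub>Cb\<^esub> \<beta> = \<beta> \<circ> \<alpha>" for \<alpha> \<beta> :: "'n free_group \<Rightarrow> 'n free_group"
    by (simp add: Cb_def)
  ultimately have "(magnus :: ('n free_group \<Rightarrow> 'n free_group) \<Rightarrow> _) \<in> hom Cb GL"
    by (intro homI) (simp_all only: mult magnus_mult, simp_all add: GL_def)
  then show ?thesis
    by (simp add: group_hom_def group_hom_axioms_def group_Cb group_GL)
qed

end

theory Submission
  imports Defs
begin

text \<open>
  The kernel contains every inner automorphism by an element \<open>f\<close> of the second derived subgroup
  of the free group.  Let \<open>\<phi>\<close> be the abelianization.  Abelianized Fox derivatives satisfy
  \<open>D (g + h) = D g + \<phi> g * D h\<close>; on the kernel of \<open>\<phi>\<close>, which contains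
  the derived subgroup, they are therefore homomorphisms into an abelian group, and so they vanish
  on commutators of elements of \<open>ker \<phi>\<close>
  (\<open>abelian_fox_commutator_eq_0\<close>).  If \<open>f \<in> ker \<phi>\<close> has all its derivatives equal to zero, then
  \<open>D (- f + g + f) = D g\<close> for all \<open>g\<close>, so the Magnus matrix of conjugation by \<open>f\<close> is the identity
  (\<open>magnus_conjugation\<close>).

  This conjugation is not the identity as soon as \<open>f\<close> is not central.  To exhibit such an \<open>f\<close> in
  the second derived subgroup, let two distinct generators act on four points as generators of the
  symmetric group \<open>S\<^sub>4\<close>, whose second derived subgroup is the Klein four-group: non-trivial, and not
  central (\<open>commutators_not_commute\<close>).
\<close>

definition commutator :: "'g::group_add \<Rightarrow> 'g \<Rightarrow> 'g"
  where "commutator g h = - g + - h + g + h"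

definition abelian_fox :: "'n \<Rightarrow> 'n free_group \<Rightarrow> 'n laurent"
  where "abelian_fox j g = abelianize (fox j (frag_of g))"

lemma abelian_fox_add:
  "abelian_fox j (g + h) = abelian_fox j g + frag_of (free_lift frag_of g) * abelian_fox j h"
  by (simp add: abelian_fox_def is_fox_derivative_frag_of[OF is_fox_derivative_fox]
      additive.add[OF additive_abelianize] abelianize_mult abelianize_frag_of)

lemma abelian_fox_zero: "abelian_fox j 0 = 0"
  using abelian_fox_add[of j 0 0] by (simp add: frag_of_0)

lemma abelian_fox_minus:
  "abelian_fox j (- g) = - (frag_of (- free_lift frag_of g) * abelian_fox j g)"
  using abelian_fox_add[of j "- g" g]
  by (simp add: abelian_fox_zero eq_neg_iff_add_eq_0)

lemma free_lift_commutator: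
  "free_lift (s :: 'n \<Rightarrow> 'g::ab_group_add) (commutator g h) = 0"
  by (simp only: commutator_def free_lift_add free_lift_minus) simp

text \<open>
  On the kernel of the abelianization the twisting factor in the product rule is \<open>1\<close>, so there the
  derivative is a homomorphism into an abelian group and kills commutators.
\<close>

lemma abelian_fox_commutator_eq_0:
  assumes "free_lift frag_of g = 0" and "free_lift frag_of h = 0"
  shows "abelian_fox j (commutator g h) = 0"
  using assms unfolding commutator_def
  by (simp only: abelian_fox_add abelian_fox_minus free_lift_add free_lift_minus) (simp add: frag_of_0)

definition conjugation :: "'g::group_add \<Rightarrow> 'g \<Rightarrow> 'g"
  where "conjugation f g = - f + g + f"

lemma conjugation_in_Cb: "conjugation f \<in> carrier Cb"
proof -
  have "bij (conjugation f)"
    by (rule bij_betw_byWitness[where f' = "conjugation (- f)"])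
      (simp_all only: conjugation_def minus_minus add.assoc add_minus_cancel minus_add_cancel
        right_minus left_minus add_0_right subset_UNIV simp_thms ball_UNIV)
  moreover have "conjugation f (g + h) = conjugation f g + conjugation f h" for g h
    by (simp only: conjugation_def add.assoc add_minus_cancel)
  ultimately show ?thesis
    by (auto simp: Cb_def conjugation_def)
qed

text \<open>
  In the expansion of \<open>D (- f + g + f)\<close> the outer two summands are multiples of \<open>D f = 0\<close>, and \<open>D g\<close>
  carries the abelianization of \<open>- f\<close> as its factor, which is \<open>1\<close>.
\<close>

lemma abelian_fox_conjugation:
  assumes "free_lift frag_of f = 0" and "abelian_fox j f = 0"
  shows "abelian_fox j (conjugation f g) = abelian_fox j g"
  using assms unfolding conjugation_def
  by (simp only: abelian_fox_add abelian_fox_minus free_lift_add free_lift_minus) (simp add: frag_of_0)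

lemma magnus_conjugation:
  assumes "free_lift frag_of f = 0" and "\<And>j. abelian_fox j f = 0"
  shows "magnus (conjugation f) = mat 1"
proof -
  have "magnus (conjugation f) = magnus id"
    using abelian_fox_conjugation[OF assms]
    by (simp add: magnus_def abelian_fox_def)
  then show ?thesis by (simp add: magnus_id)
qed

text \<open>
  Letting the letters act by mutually inverse permutations gives an invariant of the group element
  that a word represents; this is how two elements of the free group are told apart below.
\<close>

lemma foldr_word_eq:
  assumes "\<And>i b. s (i, b) \<circ> s (i, \<not> b) = id"
  shows "word_eq u v \<Longrightarrow> foldr s u = foldr s v"
proof (induction rule: word_eq.induct)
  case (cancel u i b v)
  show ?case by (simp add: assms comp_assoc[symmetric])
qed auto

text \<open>
  The letters of \<open>a\<close> and \<open>b\<close> act on the points \<open>0, 1, 2, 3\<close> by a 4-cycle and a transposition, which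
  generate \<open>S\<^sub>4\<close>.  The two inner commutators become 3-cycles that do not commute, so their commutator
  becomes a non-trivial element of the Klein four-group, and this one does not commute with the
  4-cycle.
\<close>

lemma commutators_not_commute:
  fixes a b :: 'n
  assumes "a \<noteq> b"
  defines "f \<equiv> commutator (commutator (gen a) (gen b)) (commutator (- gen a) (gen b))"
  shows "f + gen a \<noteq> gen a + f"
proof
  assume commute: "f + gen a = gen a + f"
  define p p' q :: "nat \<Rightarrow> nat"
    where "p = id(0 := 1, 1 := 2, 2 := 3, 3 := 0)"
      and "p' = id(0 := 3, 1 := 0, 2 := 1, 3 := 2)"
      and "q = id(0 := 1, 1 := 0)"
  note pq = p_def p'_def q_def
  define s where
    "s = (\<lambda>(i, e). if i = a then (if e then p else p') else if i = b then q else id)"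
  have inv: "s (i, e) \<circ> s (i, \<not> e) = id" for i e
    by (auto simp: s_def pq fun_eq_iff)
  let ?x = "(a, True)" and ?X = "(a, False)" and ?y = "(b, True)" and ?Y = "(b, False)"
  \<comment> \<open>the word spelling \<open>f\<close>; a word acts with its last letter first\<close>
  define w where "w = [?Y, ?X, ?y, ?x, ?Y, ?x, ?y, ?X, ?X, ?Y, ?x, ?y, ?x, ?Y, ?X, ?y]"
  have w: "f = abs_free_group w"
    unfolding f_def commutator_def w_def abs_free_group_Cons zero_free_group.abs_eq[symmetric]
    by (simp only: minus_add minus_minus add.assoc if_True if_False add_0_right)
  have x: "gen a = abs_free_group [?x]"
    by (simp add: gen.abs_eq)
  have "word_eq (w @ [?x]) (?x # w)"
    using commute unfolding w x plus_free_group.abs_eq free_group.abs_eq_iff by simp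
  then have "foldr s (w @ [?x]) 0 = foldr s (?x # w) 0"
    using foldr_word_eq[of s, OF inv] by metis
  then show False
    using assms(1) by (simp add: w_def s_def pq)
qed

theorem theorem2:
  assumes "CARD('n::finite) \<ge> 2"
  shows "group_hom (Cb :: ('n free_group \<Rightarrow> 'n free_group) monoid) GL magnus \<and>
         kernel (Cb :: ('n free_group \<Rightarrow> 'n free_group) monoid) GL magnus \<noteq> {\<one>\<^bsub>Cb\<^esub>}"
proof
  show "group_hom (Cb :: ('n free_group \<Rightarrow> 'n free_group) monoid) GL magnus"
    by (rule group_hom_magnus)
  have "\<not> CARD('n) \<le> Suc 0" using assms by simp
  then obtain a b :: 'n where "a \<noteq> b"
    by (auto simp: card_le_Suc0_iff_eq)
  define f where "f = commutator (commutator (gen a) (gen b)) (commutator (- gen a) (gen b))"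
  have "magnus (conjugation f) = mat 1"
    unfolding f_def
    by (intro magnus_conjugation abelian_fox_commutator_eq_0 free_lift_commutator)
  then have "conjugation f \<in> kernel Cb GL magnus"
    by (simp add: kernel_def conjugation_in_Cb GL_def)
  moreover have "conjugation f \<noteq> \<one>\<^bsub>Cb\<^esub>"
  proof
    assume "conjugation f = \<one>\<^bsub>Cb\<^esub>"
    then have "- f + gen a + f = gen a"
      by (simp add: Cb_def conjugation_def fun_eq_iff)
    then have "f + gen a = f + (- f + gen a + f)" by simp
    also have "\<dots> = gen a + f" by (simp only: add.assoc add_minus_cancel)
    finally show False
      using commutators_not_commute[OF \<open>a \<noteq> b\<close>] by (simp add: f_def)
  qed
  ultimately show "kernel (Cb :: ('n free_group \<Rightarrow> 'n free_group) monoid) GL magnus \<noteq> {\<one>\<^bsub>Cb\<^esub>}"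
    by blast
qed

end
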